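(* Any algorithm that, given a directed acyclic graph with $n$ vertices, lists all junctions of all pairs of vertices of the graph spends $\Omega(n^3)$ time in the worst case.
   Context: All paths are directed, and a single vertex counts as a (trivial) directed path. For distinct vertices $u,v$ of a directed acyclic graph $G$, a vertex $s\in G$ is a junction of $u,v$ if there are internally disjoint directed paths $P$ from $s$ to $u$ and $Q$ from $s$ to $v$ in $G$, where internally disjoint means that $s$ is the only vertex common to $P$ and $Q$. By convention no vertex is a junction of a pair $u,u$. Listing means outputting every junction explicitly, separately for each pair. *)

theory Defs
  imports "Graph_Theory.Graph_Theory" "HOL-Library.Landau_Symbols"
begin

section \<open>Junctions in directed acyclic graphs\<close>

locale dag = pair_fin_digraph +
  assumes no_cycle: "\<not> (\<exists>c. cycle c)"

definition dags :: "nat \<Rightarrow> nat pair_pre_digraph set" where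
  "dags n = {G. dag G \<and> pverts G = {0..<n}}"

definition (in pre_digraph) junction :: "'a \<Rightarrow> 'a \<Rightarrow> 'a \<Rightarrow> bool" where
  "junction u v s \<longleftrightarrow> u \<in> verts G \<and> v \<in> verts G \<and> u \<noteq> v \<and> s \<in> verts G \<and>
     (\<exists>p q. apath s p u \<and> apath s q v \<and>
        set (awalk_verts s p) \<inter> set (awalk_verts s q) = {s})"


section \<open>Random access machines with output\<close>

text \<open>
  The operations of the machine are deliberately left open: \<open>Oper f\<close> evaluates an arbitrary
  binary operation on (unbounded) words in one step, so that the programs below include those
  over every customary instruction set. \<open>Emit a b c\<close> reports the triple stored in three
  registers, i.e. one junction of one pair, and is the only way to produce output.
\<close>

datatype instr =
    Const nat nat
  | Oper "nat \<Rightarrow> nat \<Rightarrow> nat" nat nat nat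
  | Load nat nat
  | Store nat nat
  | JumpZ nat nat
  | Emit nat nat nat

type_synonym program = "instr list"

type_synonym memory = "nat \<Rightarrow> nat"

record config =
  pc :: nat
  mem :: memory
  out :: "(nat \<times> nat \<times> nat) list"

fun exec :: "instr \<Rightarrow> config \<Rightarrow> config" where
  "exec (Const a k) c = c\<lparr>pc := pc c + 1, mem := (mem c)(a := k)\<rparr>"
| "exec (Oper f a b d) c = c\<lparr>pc := pc c + 1, mem := (mem c)(a := f (mem c b) (mem c d))\<rparr>"
| "exec (Load a b) c = c\<lparr>pc := pc c + 1, mem := (mem c)(a := mem c (mem c b))\<rparr>"
| "exec (Store a b) c = c\<lparr>pc := pc c + 1, mem := (mem c)(mem c a := mem c b)\<rparr>"
| "exec (JumpZ a l) c = c\<lparr>pc := (if mem c a = 0 then l else pc c + 1)\<rparr>"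
| "exec (Emit a b d) c = c\<lparr>pc := pc c + 1, out := out c @ [(mem c a, mem c b, mem c d)]\<rparr>"

definition halted :: "program \<Rightarrow> config \<Rightarrow> bool" where
  "halted prog c \<longleftrightarrow> length prog \<le> pc c"

definition step :: "program \<Rightarrow> config \<Rightarrow> config" where
  "step prog c = (if halted prog c then c else exec (prog ! pc c) c)"

definition run :: "program \<Rightarrow> memory \<Rightarrow> nat \<Rightarrow> config" where
  "run prog m t = (step prog ^^ t) \<lparr>pc = 0, mem = m, out = []\<rparr>"

definition terminates :: "program \<Rightarrow> memory \<Rightarrow> bool" where
  "terminates prog m \<longleftrightarrow> (\<exists>t. halted prog (run prog m t))"

definition running_time :: "program \<Rightarrow> memory \<Rightarrow> nat" where
  "running_time prog m = (LEAST t. halted prog (run prog m t))"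

definition ram_output :: "program \<Rightarrow> memory \<Rightarrow> (nat \<times> nat \<times> nat) list" where
  "ram_output prog m = out (run prog m (running_time prog m))"


section \<open>Listing all junctions\<close>

text \<open>
  Pairs are unordered, so a junction of a pair needs to be reported for only one of the two
  orientations. Order and repetitions of the output are irrelevant.
\<close>

definition lists_junctions :: "nat pair_pre_digraph \<Rightarrow> (nat \<times> nat \<times> nat) list \<Rightarrow> bool" where
  "lists_junctions G xs \<longleftrightarrow>
     (\<forall>(u, v, s) \<in> set xs. pre_digraph.junction (with_proj G) u v s) \<and>
     (\<forall>u v s. pre_digraph.junction (with_proj G) u v s \<longrightarrow>
        (u, v, s) \<in> set xs \<or> (v, u, s) \<in> set xs)"

text \<open>The parameter \<open>enc\<close> is the way in which a graph is presented in the initial memory.\<close>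

definition lists_all_junctions :: "(nat pair_pre_digraph \<Rightarrow> memory) \<Rightarrow> program \<Rightarrow> bool" where
  "lists_all_junctions enc prog \<longleftrightarrow>
     (\<forall>n. \<forall>G \<in> dags n. terminates prog (enc G) \<and> lists_junctions G (ram_output prog (enc G)))"

definition worst_case_time :: "(nat pair_pre_digraph \<Rightarrow> memory) \<Rightarrow> program \<Rightarrow> nat \<Rightarrow> nat" where
  "worst_case_time enc prog n = Max ((\<lambda>G. running_time prog (enc G)) ` dags n)"

text \<open>The maximum is taken over a finite nonempty set.\<close>

lemma finite_dags: "finite (dags n)"
proof (rule finite_subset)
  show "dags n \<subseteq> (\<lambda>E. \<lparr>pverts = {0..<n}, parcs = E\<rparr>) ` Pow ({0..<n} \<times> {0..<n})"
  proof
    fix G assume "G \<in> dags n"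
    then have V: "pverts G = {0..<n}" and "pair_wf_digraph G"
      by (auto simp: dags_def dag_def pair_fin_digraph_def)
    then have "parcs G \<subseteq> {0..<n} \<times> {0..<n}"
      by (auto dest: pair_wf_digraph.in_arcsD1 pair_wf_digraph.in_arcsD2)
    moreover have "G = \<lparr>pverts = {0..<n}, parcs = parcs G\<rparr>"
      using V by (cases G) simp
    ultimately show "G \<in> (\<lambda>E. \<lparr>pverts = {0..<n}, parcs = E\<rparr>) ` Pow ({0..<n} \<times> {0..<n})"
      by blast
  qed
qed simp

lemma dags_nonempty: "dags n \<noteq> {}"
proof -
  have "\<lparr>pverts = {0..<n}, parcs = {}\<rparr> \<in> dags n"
    by (auto simp: dags_def dag_def dag_axioms_def pair_fin_digraph_def
        pair_fin_digraph_axioms_def pair_wf_digraph_def pre_digraph.cycle_def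
        pre_digraph.awalk_def)
  then show ?thesis by blast
qed

end

theory Submission
  imports Defs
begin

text \<open>
  A machine emits at most one triple per step, so it suffices to find dags with cubically many
  junctions. Let every one of the first \<open>m = n div 3\<close> vertices point to all the others: then each
  of them is a junction of any two distinct later vertices.
\<close>

lemma length_out_exec: "length (out (exec i c)) \<le> Suc (length (out c))"
  by (cases i) simp_all

text \<open>The output starts empty; a step either leaves a halted configuration unchanged or
  executes one instruction, and only \<open>Emit\<close> lengthens the output, by a single
  triple.\<close>

lemma length_out_run: "length (out (run prog m t)) \<le> t"
proof (induction t)
  case (Suc t)
  have "length (out (step prog c)) \<le> Suc (length (out c))" for c
    by (simp add: step_def length_out_exec)
  from this[of "run prog m t"] Suc show ?case
    by (simp add: run_def)
qed (simp add: run_def)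

lemma length_ram_output: "length (ram_output prog m) \<le> running_time prog m"
  by (simp add: ram_output_def length_out_run)

definition complete_bipartite_dag :: "nat \<Rightarrow> nat \<Rightarrow> nat pair_pre_digraph" where
  "complete_bipartite_dag m n = \<lparr>pverts = {0..<n}, parcs = {0..<m} \<times> {m..<n}\<rparr>"

text \<open>Every arc has its tail below \<open>m\<close> and its head at or above \<open>m\<close>.
  The base vertex of a cycle would be both the tail of the first arc and the head of the last
  one.\<close>

lemma complete_bipartite_dag_in_dags:
  assumes "m \<le> n"
  shows "complete_bipartite_dag m n \<in> dags n"
proof -
  let ?G = "complete_bipartite_dag m n"
  have fin: "pair_fin_digraph ?G"
    using assms by unfold_locales (auto simp: complete_bipartite_dag_def)
  have "\<not> pre_digraph.cycle (with_proj ?G) c" for c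
  proof
    assume "pre_digraph.cycle (with_proj ?G) c"
    then obtain u where c: "c \<noteq> []" "set c \<subseteq> {0..<m} \<times> {m..<n}"
        and cas: "pre_digraph.cas (with_proj ?G) u c u"
      by (auto simp: pre_digraph.cycle_def pre_digraph.awalk_def complete_bipartite_dag_def)
    have ends: "u = fst (hd p) \<and> v = snd (last p)"
      if "p \<noteq> []" "pre_digraph.cas (with_proj ?G) u p v" for u p v
      using that by (induction p arbitrary: u) (auto simp: pre_digraph.cas.simps)
    have "hd c \<in> {0..<m} \<times> {m..<n}" "last c \<in> {0..<m} \<times> {m..<n}"
      using c hd_in_set last_in_set by blast+
    with ends[OF c(1) cas] show False by auto
  qed
  with fin show ?thesis
    by (simp add: dags_def dag_def dag_axioms_def) (simp add: complete_bipartite_dag_def)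
qed

text \<open>The single arcs from \<open>s\<close> to \<open>u\<close> and from \<open>s\<close> to
  \<open>v\<close> serve as the two paths. They meet only in \<open>s\<close>, because
  \<open>u\<close> and \<open>v\<close> are distinct.\<close>

lemma junction_complete_bipartite_dag:
  assumes "s < m" "u \<in> {m..<n}" "v \<in> {m..<n}" "u \<noteq> v"
  shows "pre_digraph.junction (with_proj (complete_bipartite_dag m n)) u v s"
proof -
  let ?G = "with_proj (complete_bipartite_dag m n)"
  have arc: "pre_digraph.apath ?G s [(s, w)] w" if "w \<in> {m..<n}" for w
    using that assms(1)
    by (auto simp: pre_digraph.apath_def pre_digraph.awalk_def pre_digraph.cas.simps
        pre_digraph.awalk_verts.simps complete_bipartite_dag_def)
  have "set (pre_digraph.awalk_verts ?G s [(s, u)]) \<inter>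
      set (pre_digraph.awalk_verts ?G s [(s, v)]) = {s}"
    using assms by (auto simp: pre_digraph.awalk_verts.simps)
  with arc[OF assms(2)] arc[OF assms(3)] assms show ?thesis
    unfolding pre_digraph.junction_def by (auto simp: complete_bipartite_dag_def)
qed

lemma lists_junctions_complete_bipartite_dag:
  assumes "lists_junctions (complete_bipartite_dag m n) xs" "3 * m \<le> n"
  shows "m ^ 3 \<le> length xs"
proof -
  \<comment> \<open>Taking the ends from two consecutive blocks forces \<open>u < v\<close>, so each
    unordered pair is counted once and \<open>?T\<close> has exactly \<open>m ^ 3\<close>
    elements.\<close>
  let ?T = "{m..<2*m} \<times> {2*m..<3*m} \<times> {0..<m}"
  \<comment> \<open>The list may report a pair in either orientation; sorting the ends sends both to
    the same triple of \<open>?T\<close>.\<close>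
  let ?sort = "\<lambda>(u, v, s). (min u v, max u v, s :: nat)"
  have "?T \<subseteq> ?sort ` set xs"
  proof clarify
    fix u v s assume uvs: "u \<in> {m..<2*m}" "v \<in> {2*m..<3*m}" "s \<in> {0..<m}"
    then have "pre_digraph.junction (with_proj (complete_bipartite_dag m n)) u v s"
      using assms(2) by (intro junction_complete_bipartite_dag) auto
    then have "(u, v, s) \<in> set xs \<or> (v, u, s) \<in> set xs"
      using assms(1) by (auto simp: lists_junctions_def)
    moreover have "(u, v, s) = ?sort (u, v, s)" "(u, v, s) = ?sort (v, u, s)"
      using uvs by auto
    ultimately show "(u, v, s) \<in> ?sort ` set xs" by (elim disjE) (rule image_eqI; assumption)+
  qed
  then have "card ?T \<le> card (?sort ` set xs)" by (intro card_mono) auto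
  \<comment> \<open>Only an inequality, since repetitions in the list and the merging of
    orientations can both lower the cardinality.\<close>
  also have "\<dots> \<le> length xs"
    by (meson List.finite_set card_image_le card_length le_trans)
  finally show ?thesis by (simp add: card_cartesian_product power3_eq_cube)
qed

text \<open>One hard input per \<open>n\<close> suffices, as the worst case is a maximum over all
  dags on \<open>n\<close> vertices.\<close>

lemma worst_case_time_ge:
  assumes "lists_all_junctions enc prog"
  shows "(n div 3) ^ 3 \<le> worst_case_time enc prog n"
proof -
  \<comment> \<open>\<open>n div 3\<close> is the largest block size for which three disjoint blocks
    fit into \<open>n\<close> vertices.\<close>
  let ?G = "complete_bipartite_dag (n div 3) n"
  have G: "?G \<in> dags n" by (intro complete_bipartite_dag_in_dags) simp
  with assms have "lists_junctions ?G (ram_output prog (enc ?G))"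
    by (auto simp: lists_all_junctions_def)
  then have "(n div 3) ^ 3 \<le> length (ram_output prog (enc ?G))"
    by (rule lists_junctions_complete_bipartite_dag) simp
  also have "\<dots> \<le> running_time prog (enc ?G)" by (rule length_ram_output)
  also have "\<dots> \<le> worst_case_time enc prog n"
    unfolding worst_case_time_def using G by (intro Max_ge) (auto simp: finite_dags)
  finally show ?thesis .
qed

theorem mainTheorem4:
  fixes enc :: "nat pair_pre_digraph \<Rightarrow> memory" and prog :: program
  assumes "lists_all_junctions enc prog"
  shows "(\<lambda>n. real (worst_case_time enc prog n)) \<in> \<Omega>(\<lambda>n. real n ^ 3)"
proof (rule landau_omega.bigI[of "1 / 125"])
  have "1 / 125 * real n ^ 3 \<le> real (worst_case_time enc prog n)" if "n \<ge> 3" for n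
  proof -
    \<comment> \<open>With \<open>q = n div 3\<close> at least 1, \<open>n\<close> is at most
      \<open>3 * q + 2\<close>, hence at most \<open>5 * q\<close>, with equality at
      \<open>n = 5\<close>. Cubing the factor 5 gives the constant 125.\<close>
    have "n \<le> 5 * (n div 3)" using that by presburger
    then have "n ^ 3 \<le> 125 * (n div 3) ^ 3"
      using power_mono[of n "5 * (n div 3)" 3] by (simp add: power_mult_distrib)
    also have "\<dots> \<le> 125 * worst_case_time enc prog n"
      using worst_case_time_ge[OF assms] by simp
    finally have "real (n ^ 3) \<le> real (125 * worst_case_time enc prog n)"
      by (rule of_nat_mono)
    then show ?thesis by simp
  qed
  then show "\<forall>\<^sub>F n in at_top. norm (real (worst_case_time enc prog n)) \<ge> 1 / 125 * norm (real n ^ 3)"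
    by (auto simp: eventually_at_top_linorder intro!: exI[of _ 3])
qed simp

end
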